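(* For every $n\ge 2$, every $K\ge 1$, every $d\ge 1$, and all real symmetric $d\times d$ matrices $A_1,\dots,A_n$ with $$\Bigl(1-\frac1{4n^2+1}\Bigr)I\preceq A_i\preceq I\qquad(1\le i\le n),$$ one has $\lVert W_{\mathrm{RS}}\rVert\le\lVert W_{\mathrm{GD}}\rVert$.
   Context: For real symmetric $d\times d$ matrices $A_1,\dots,A_n$ and a permutation $\sigma\in\mathfrak{S}_n$ (the symmetric group on $\{1,\dots,n\}$), let $P_\sigma:=A_{\sigma(1)}A_{\sigma(2)}\cdots A_{\sigma(n)}$ and define $$W_{\mathrm{RS}}:=\Bigl(\frac1{n!}\sum_{\sigma\in\mathfrak{S}_n}P_\sigma\Bigr)^{K},\qquad W_{\mathrm{GD}}:=\Bigl(\frac1n\sum_{i=1}^nA_i\Bigr)^{nK}.$$ Here $n,K,d$ are integers, $I$ is the identity matrix, $\preceq$ is the Löwner order ($X\preceq Y$ iff $Y-X$ is positive semidefinite), and $\lVert\cdot\rVert$ is the spectral norm (largest singular value). *)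

theory Defs
  imports "HOL-Analysis.Analysis" "HOL-Combinatorics.Permutations"
begin

definition symmetric_matrix :: "real ^ 'd ^ 'd \<Rightarrow> bool" where
  "symmetric_matrix M \<longleftrightarrow> transpose M = M"

definition positive_semidefinite :: "real ^ 'd ^ 'd \<Rightarrow> bool" where
  "positive_semidefinite M \<longleftrightarrow> symmetric_matrix M \<and> (\<forall>x. 0 \<le> x \<bullet> (M *v x))"

definition loewner_le :: "real ^ 'd ^ 'd \<Rightarrow> real ^ 'd ^ 'd \<Rightarrow> bool"  (infix "\<preceq>" 50) where
  "X \<preceq> Y \<longleftrightarrow> positive_semidefinite (Y - X)"

text \<open>The singular values of \<open>M\<close> are the nonnegative square roots of the eigenvalues of
  \<open>M\<^sup>T M\<close>.\<close>

definition singular_values :: "real ^ 'd ^ 'd \<Rightarrow> real set" where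
  "singular_values M =
    {s. 0 \<le> s \<and> (\<exists>v. v \<noteq> 0 \<and> (transpose M ** M) *v v = s\<^sup>2 *\<^sub>R v)}"

text \<open>\<open>Max\<close> is meaningful here because \<open>singular_values M\<close> is finite and nonempty; this, and the
  agreement with the operator norm, is proved below.\<close>

definition spectral_norm :: "real ^ 'd ^ 'd \<Rightarrow> real" where
  "spectral_norm M = Max (singular_values M)"

text \<open>A separate power function, since \<open>*\<close> on \<^typ>\<open>real ^ 'd ^ 'd\<close> is componentwise.\<close>

primrec matrix_power :: "real ^ 'd ^ 'd \<Rightarrow> nat \<Rightarrow> real ^ 'd ^ 'd" where
  "matrix_power M 0 = mat 1"
| "matrix_power M (Suc k) = M ** matrix_power M k"

definition perm_product ::
    "nat \<Rightarrow> (nat \<Rightarrow> real ^ 'd ^ 'd) \<Rightarrow> (nat \<Rightarrow> nat) \<Rightarrow> real ^ 'd ^ 'd" where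
  "perm_product n A \<sigma> = foldr (\<lambda>i M. A (\<sigma> i) ** M) [1..<n + 1] (mat 1)"

definition W_RS :: "nat \<Rightarrow> nat \<Rightarrow> (nat \<Rightarrow> real ^ 'd ^ 'd) \<Rightarrow> real ^ 'd ^ 'd" where
  "W_RS n K A =
    matrix_power ((1 / fact n) *\<^sub>R (\<Sum>\<sigma> | \<sigma> permutes {1..n}. perm_product n A \<sigma>)) K"

definition W_GD :: "nat \<Rightarrow> nat \<Rightarrow> (nat \<Rightarrow> real ^ 'd ^ 'd) \<Rightarrow> real ^ 'd ^ 'd" where
  "W_GD n K A = matrix_power ((1 / real n) *\<^sub>R (\<Sum>i = 1..n. A i)) (n * K)"

lemma inner_transpose_mult:
  fixes M :: "real ^ 'd ^ 'd"
  shows "x \<bullet> ((transpose M ** M) *v y) = (M *v x) \<bullet> (M *v y)"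
proof -
  have "(M *v x) \<bullet> (M *v y) = (x v* transpose M) \<bullet> (M *v y)"
    by simp
  also have "\<dots> = x \<bullet> (transpose M *v (M *v y))"
    by (rule dot_lmul_matrix)
  finally show ?thesis
    by (simp only: matrix_vector_mul_assoc)
qed

lemma finite_singular_values:
  fixes M :: "real ^ 'd ^ 'd"
  shows "finite (singular_values M)"
proof -
  have "\<forall>s\<in>singular_values M. \<exists>v. v \<noteq> 0 \<and> (transpose M ** M) *v v = s\<^sup>2 *\<^sub>R v"
    by (simp add: singular_values_def)
  from bchoice[OF this] obtain v where "\<forall>s\<in>singular_values M.
      v s \<noteq> 0 \<and> (transpose M ** M) *v v s = s\<^sup>2 *\<^sub>R v s" ..
  then have v: "v s \<noteq> 0 \<and> (transpose M ** M) *v v s = s\<^sup>2 *\<^sub>R v s"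
    if "s \<in> singular_values M" for s
    using that by blast
  have orth: "v s \<bullet> v t = 0"
    if s: "s \<in> singular_values M" and t: "t \<in> singular_values M" and "s \<noteq> t" for s t
  proof -
    have "v s \<bullet> (t\<^sup>2 *\<^sub>R v t) = v t \<bullet> (s\<^sup>2 *\<^sub>R v s)"
      using v[OF s] v[OF t] inner_transpose_mult[of "v s" M "v t"]
        inner_transpose_mult[of "v t" M "v s"] by (simp add: inner_commute)
    then have "t\<^sup>2 * (v s \<bullet> v t) = s\<^sup>2 * (v s \<bullet> v t)"
      by (simp add: inner_commute)
    moreover have "t\<^sup>2 \<noteq> s\<^sup>2"
      using s t \<open>s \<noteq> t\<close> by (auto simp: singular_values_def power2_eq_iff_nonneg)
    ultimately show ?thesis by simp
  qed
  have inj: "inj_on v (singular_values M)"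
    by (rule inj_onI) (metis inner_eq_zero_iff orth v)
  have "pairwise orthogonal (v ` singular_values M)"
    unfolding pairwise_def orthogonal_def using orth by (metis imageE)
  moreover have "0 \<notin> v ` singular_values M"
    using v by (metis imageE)
  ultimately have "independent (v ` singular_values M)"
    by (rule pairwise_orthogonal_independent)
  then have "finite (v ` singular_values M)"
    using independent_bound by blast
  then show ?thesis
    using inj finite_image_iff by blast
qed

lemma onorm_in_singular_values:
  fixes M :: "real ^ 'd ^ 'd"
  shows "onorm ((*v) M) \<in> singular_values M"
proof -
  define c where "c = onorm ((*v) M)"
  have lin: "bounded_linear ((*v) M)"
    by (rule matrix_vector_mul_bounded_linear)
  have c: "norm (M *v x) \<le> c * norm x" for x
    unfolding c_def by (rule onorm[OF lin])
  have "0 \<le> c"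
    unfolding c_def by (rule onorm_pos_le[OF lin])
  have ct: "norm (transpose M *v y) \<le> c * norm y" for y
  proof (cases "transpose M *v y = 0")
    case True
    then show ?thesis using \<open>0 \<le> c\<close> by simp
  next
    case False
    have "norm (transpose M *v y) * norm (transpose M *v y) = y \<bullet> (M *v (transpose M *v y))"
      by (metis dot_lmul_matrix transpose_matrix_vector dot_square_norm power2_eq_square)
    also have "\<dots> \<le> norm y * norm (M *v (transpose M *v y))"
      by (rule norm_cauchy_schwarz)
    also have "\<dots> \<le> norm y * (c * norm (transpose M *v y))"
      by (intro mult_left_mono c norm_ge_zero)
    finally have "norm (transpose M *v y) * norm (transpose M *v y)
        \<le> (c * norm y) * norm (transpose M *v y)"
      by (simp add: ac_simps)
    then show ?thesis using False by simp
  qed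
  have "\<exists>v\<in>sphere 0 1. \<forall>x\<in>sphere 0 1. norm (M *v x) \<le> norm (M *v v)"
    by (intro continuous_attains_sup continuous_on_norm linear_continuous_on lin) auto
  then obtain v where v: "norm v = 1"
    and max: "\<And>x. norm x = 1 \<Longrightarrow> norm (M *v x) \<le> norm (M *v v)"
    by auto
  have "c \<le> norm (M *v v)"
    unfolding c_def
  proof (rule onorm_le)
    fix x
    show "norm (M *v x) \<le> norm (M *v v) * norm x"
    proof (cases "x = 0")
      case False
      then show ?thesis
        using max[of "inverse (norm x) *\<^sub>R x"]
        by (simp add: matrix_vector_mult_scaleR field_simps)
    qed simp
  qed
  then have cv: "norm (M *v v) = c"
    using c[of v] v by simp
  define w where "w = (transpose M ** M) *v v"
  have "norm w \<le> c * c"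
    using ct[of "M *v v"] by (simp add: w_def cv flip: matrix_vector_mul_assoc)
  then have "w \<bullet> w \<le> (c * c)\<^sup>2"
    by (simp add: dot_square_norm power_mono)
  moreover have "v \<bullet> w = c\<^sup>2"
    unfolding w_def by (simp add: inner_transpose_mult dot_square_norm cv)
  moreover have "v \<bullet> v = 1"
    using v by (simp add: dot_square_norm)
  ultimately have "(w - c\<^sup>2 *\<^sub>R v) \<bullet> (w - c\<^sup>2 *\<^sub>R v) \<le> 0"
    by (simp add: algebra_simps inner_commute power2_eq_square)
  then have "w - c\<^sup>2 *\<^sub>R v = 0"
    by (meson inner_gt_zero_iff not_less)
  then have "w = c\<^sup>2 *\<^sub>R v"
    by simp
  moreover have "v \<noteq> 0"
    using v by auto
  ultimately show ?thesis
    using \<open>0 \<le> c\<close> unfolding singular_values_def w_def c_def by blast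
qed

lemma singular_value_le_onorm:
  fixes M :: "real ^ 'd ^ 'd"
  assumes "s \<in> singular_values M"
  shows "s \<le> onorm ((*v) M)"
proof -
  obtain v where v: "v \<noteq> 0" "(transpose M ** M) *v v = s\<^sup>2 *\<^sub>R v" and "0 \<le> s"
    using assms by (auto simp: singular_values_def)
  have "(norm (M *v v))\<^sup>2 = (s * norm v)\<^sup>2"
    using inner_transpose_mult[of v M v] v
    by (simp add: power2_norm_eq_inner power_mult_distrib)
  then have "s * norm v = norm (M *v v)"
    using \<open>0 \<le> s\<close> by (simp add: power2_eq_iff_nonneg)
  also have "\<dots> \<le> onorm ((*v) M) * norm v"
    by (rule onorm) (simp add: linear_linear)
  finally show ?thesis using v(1) by simp
qed

lemma spectral_norm_eq_onorm:
  fixes M :: "real ^ 'd ^ 'd"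
  shows "spectral_norm M = onorm ((*v) M)"
  unfolding spectral_norm_def
  by (intro Max_eqI finite_singular_values singular_value_le_onorm onorm_in_singular_values)

end

theory Submission
  imports Defs
begin

text \<open>Let \<open>M\<close> be the mean of the \<open>A\<^sub>i\<close> and \<open>\<mu> = \<parallel>M\<parallel>\<close>. Write \<open>A\<^sub>i = \<mu> (I - H\<^sub>i)\<close>; then
  \<open>\<parallel>H\<^sub>i\<parallel> \<le> \<delta> = 1 / (4 n\<^sup>2)\<close>, and \<open>T = \<Sum>\<^sub>i H\<^sub>i\<close> is positive semidefinite. For every ordering of the
  factors, expanding to second order gives
  \<open>\<langle>x, \<Prod>(I - H\<^sub>i) x\<rangle> = |x|\<^sup>2 - \<langle>x, T x\<rangle> + \<Sum>\<^sub>i\<^sub><\<^sub>j \<langle>H\<^sub>i x, H\<^sub>j x\<rangle> + r\<close>, where the sum over \<open>i < j\<close> equals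
  \<open>(|T x|\<^sup>2 - q) / 2\<close> with \<open>q = \<Sum>\<^sub>i |H\<^sub>i x|\<^sup>2\<close>, whatever the ordering, and \<open>|r| \<le> q / 4\<close>. As \<open>\<parallel>T\<parallel> \<le> n \<delta>\<close> is
  small, \<open>|T x|\<^sup>2 / 2 \<le> \<langle>x, T x\<rangle>\<close>, so that each quadratic form \<open>\<langle>x, P\<^sub>\<sigma> x\<rangle>\<close> lies between \<open>0\<close> and
  \<open>\<mu>\<^sup>n |x|\<^sup>2\<close>. The average of the \<open>P\<^sub>\<sigma>\<close> is symmetric, because reversing the factors permutes the
  \<open>\<sigma>\<close>, and therefore has norm at most \<open>\<mu>\<^sup>n\<close>; and \<open>\<parallel>M\<^sup>n\<^sup>K\<parallel> = \<mu>\<^sup>n\<^sup>K\<close> as \<open>M\<close> is positive semidefinite.\<close>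

section \<open>Products of operators close to the identity\<close>

text \<open>The coefficient \<open>1 + 2 * m * \<delta>\<close> for \<open>m\<close> factors is a
  linear substitute for \<open>(1 + \<delta>) ^ m\<close>: multiplying it by
  \<open>1 + \<delta>\<close> stays below the next coefficient as long as
  \<open>2 * m * \<delta> \<le> 1\<close>. The bound keeps the \<open>norm (H i x)\<close> instead
  of \<open>\<delta> * norm x\<close>, so that errors can later be absorbed by the sum of their
  squares.\<close>

lemma norm_foldr_minus_le:
  fixes H :: "'i \<Rightarrow> 'v::real_normed_vector \<Rightarrow> 'v"
  assumes "\<And>i. i \<in> set xs \<Longrightarrow> linear (H i)"
    and "\<And>i v. i \<in> set xs \<Longrightarrow> norm (H i v) \<le> \<delta> * norm v"
    and "0 \<le> \<delta>" and "2 * real (length xs) * \<delta> \<le> 1" and "distinct xs"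
  shows "norm (foldr (\<lambda>i v. v - H i v) xs x - x)
    \<le> (1 + 2 * real (length xs) * \<delta>) * (\<Sum>i\<in>set xs. norm (H i x))"
  using assms
proof (induction xs)
  case (Cons i xs)
  define r where "r = foldr (\<lambda>i v. v - H i v) xs x"
  define m where "m = real (length xs)"
  define s where "s = (\<Sum>i\<in>set xs. norm (H i x))"
  have "0 \<le> s" "0 \<le> m" "0 \<le> m * \<delta>" using Cons.prems(3) by (simp_all add: s_def m_def sum_nonneg)
  have m: "2 * m * \<delta> \<le> 1" using Cons.prems(3,4) by (simp add: m_def algebra_simps)
  have IH: "norm (r - x) \<le> (1 + 2 * m * \<delta>) * s"
    unfolding r_def m_def s_def using Cons m by (intro Cons.IH) (simp_all add: m_def)
  interpret linear "H i" using Cons.prems(1) by simp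
  have eq: "(r - H i r) - x = (r - x) - H i (r - x) - H i x"
    by (simp add: diff)
  have "norm ((r - H i r) - x) \<le> norm (r - x) + norm (H i (r - x)) + norm (H i x)"
    unfolding eq using norm_triangle_ineq4[of "(r - x) - H i (r - x)" "H i x"]
      norm_triangle_ineq4[of "r - x" "H i (r - x)"] by linarith
  also have "\<dots> \<le> (1 + \<delta>) * norm (r - x) + norm (H i x)"
    using Cons.prems(2)[of i "r - x"] by (simp add: algebra_simps)
  also have "(1 + \<delta>) * norm (r - x) \<le> (1 + \<delta>) * ((1 + 2 * m * \<delta>) * s)"
    using IH Cons.prems(3) by (intro mult_left_mono) auto
  also have "\<dots> = (1 + \<delta> + 2 * m * \<delta> + (2 * m * \<delta>) * \<delta>) * s" by (simp add: algebra_simps)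
  also have "\<dots> \<le> (1 + \<delta> + 2 * m * \<delta> + 1 * \<delta>) * s"
    using m Cons.prems(3) \<open>0 \<le> s\<close> by (intro mult_right_mono add_left_mono) auto
  also have "\<dots> = (1 + 2 * (m + 1) * \<delta>) * s" by (simp add: algebra_simps)
  also have "norm (H i x) \<le> (1 + 2 * (m + 1) * \<delta>) * norm (H i x)"
    using \<open>0 \<le> m * \<delta>\<close> Cons.prems(3)
      mult_right_mono[of 1 "1 + 2 * (m + 1) * \<delta>" "norm (H i x)"] by (simp add: algebra_simps)
  finally have "norm ((r - H i r) - x) \<le> (1 + 2 * (m + 1) * \<delta>) * (norm (H i x) + s)"
    unfolding distrib_left by linarith
  moreover have "(\<Sum>i\<in>set (i # xs). norm (H i x)) = norm (H i x) + s"
    using Cons.prems(5) by (simp add: s_def)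
  moreover have "real (length (i # xs)) = m + 1" by (simp add: m_def)
  ultimately show ?case by (simp only: foldr_Cons o_apply r_def)
qed simp

text \<open>A new outermost factor adds the error \<open>H i (r - x)\<close>, where \<open>r\<close>
  is the result of the other factors. The previous bound makes this at most
  \<open>2 * \<delta>\<close> times the sum of their norms, hence the growth of the coefficient by
  \<open>2 * \<delta>\<close> per factor.\<close>

lemma norm_foldr_minus_first_order_le:
  fixes H :: "'i \<Rightarrow> 'v::real_normed_vector \<Rightarrow> 'v"
  assumes "\<And>i. i \<in> set xs \<Longrightarrow> linear (H i)"
    and "\<And>i v. i \<in> set xs \<Longrightarrow> norm (H i v) \<le> \<delta> * norm v"
    and "0 \<le> \<delta>" and "2 * real (length xs) * \<delta> \<le> 1" and "distinct xs"
  shows "norm (foldr (\<lambda>i v. v - H i v) xs x - x + (\<Sum>i\<in>set xs. H i x))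
    \<le> 2 * real (length xs) * \<delta> * (\<Sum>i\<in>set xs. norm (H i x))"
  using assms
proof (induction xs)
  case (Cons i xs)
  define r where "r = foldr (\<lambda>i v. v - H i v) xs x"
  define m where "m = real (length xs)"
  define s where "s = (\<Sum>i\<in>set xs. norm (H i x))"
  define w where "w = (\<Sum>i\<in>set xs. H i x)"
  have "0 \<le> s" by (simp add: s_def sum_nonneg)
  have m: "2 * m * \<delta> \<le> 1" using Cons.prems(3,4) by (simp add: m_def algebra_simps)
  have "0 \<le> m * \<delta>" using Cons.prems(3) by (simp add: m_def)
  have IH: "norm (r - x + w) \<le> 2 * m * \<delta> * s"
    unfolding r_def m_def s_def w_def using Cons m by (intro Cons.IH) (simp_all add: m_def)
  have "norm (r - x) \<le> (1 + 2 * m * \<delta>) * s"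
    unfolding r_def m_def s_def
    using Cons.prems m by (intro norm_foldr_minus_le) (simp_all add: m_def)
  also have "\<dots> \<le> 2 * s" using m \<open>0 \<le> s\<close> by (intro mult_right_mono) auto
  finally have rx: "\<delta> * norm (r - x) \<le> \<delta> * (2 * s)" using Cons.prems(3) by (intro mult_left_mono)
  interpret linear "H i" using Cons.prems(1) by simp
  have "(r - H i r) - x + (H i x + w) = (r - x + w) - H i (r - x)"
    by (simp add: diff)
  then have "norm ((r - H i r) - x + (H i x + w)) \<le> norm (r - x + w) + norm (H i (r - x))"
    by (metis norm_triangle_ineq4)
  also have "\<dots> \<le> 2 * m * \<delta> * s + \<delta> * (2 * s)"
    using IH rx Cons.prems(2)[of i "r - x"] by simp
  also have "\<dots> = 2 * (m + 1) * \<delta> * s" by (simp add: algebra_simps)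
  also have "\<dots> \<le> 2 * (m + 1) * \<delta> * (norm (H i x) + s)"
    using \<open>0 \<le> m * \<delta>\<close> Cons.prems(3) by (intro mult_left_mono) (auto simp: algebra_simps)
  finally have "norm ((r - H i r) - x + (H i x + w)) \<le> 2 * (m + 1) * \<delta> * (norm (H i x) + s)" .
  then show ?case using Cons.prems(5) by (simp add: r_def m_def s_def w_def add.commute)
qed simp

text \<open>Self-adjointness moves \<open>H i\<close> onto the left-hand \<open>x\<close>, so the
  second-order terms become \<open>H i x \<bullet> H j x\<close>, whose sum over pairs is
  independent of the ordering. The last summand collects the remainders,
  \<open>2 * \<eta> * norm (H i x) * norm (H j x)\<close> for each pair. The constant
  \<open>\<eta>\<close> stays fixed while the list shrinks in the induction.\<close>

lemma inner_foldr_minus_second_order_le: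
  fixes H :: "'i \<Rightarrow> 'v::real_inner \<Rightarrow> 'v"
  assumes "\<And>i. i \<in> set xs \<Longrightarrow> linear (H i)"
    and "\<And>i v. i \<in> set xs \<Longrightarrow> norm (H i v) \<le> \<delta> * norm v"
    and "\<And>i u v. i \<in> set xs \<Longrightarrow> u \<bullet> H i v = H i u \<bullet> v"
    and "0 \<le> \<delta>" and "2 * \<eta> \<le> 1" and "real (length xs) * \<delta> \<le> \<eta>" and "distinct xs"
  shows "x \<bullet> foldr (\<lambda>i v. v - H i v) xs x
    \<le> (norm x)\<^sup>2 - x \<bullet> (\<Sum>i\<in>set xs. H i x)
      + ((norm (\<Sum>i\<in>set xs. H i x))\<^sup>2 - (\<Sum>i\<in>set xs. (norm (H i x))\<^sup>2)) / 2
      + \<eta> * ((\<Sum>i\<in>set xs. norm (H i x))\<^sup>2 - (\<Sum>i\<in>set xs. (norm (H i x))\<^sup>2))"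
  using assms
proof (induction xs)
  case (Cons i xs)
  define r where "r = foldr (\<lambda>i v. v - H i v) xs x"
  define s where "s = (\<Sum>i\<in>set xs. norm (H i x))"
  define w where "w = (\<Sum>i\<in>set xs. H i x)"
  define q where "q = (\<Sum>i\<in>set xs. (norm (H i x))\<^sup>2)"
  have "0 \<le> s" by (simp add: s_def sum_nonneg)
  have m: "real (length xs) * \<delta> \<le> \<eta>" using Cons.prems(4,6) by (simp add: algebra_simps)
  have IH: "x \<bullet> r \<le> (norm x)\<^sup>2 - x \<bullet> w + ((norm w)\<^sup>2 - q) / 2 + \<eta> * (s\<^sup>2 - q)"
    unfolding r_def s_def w_def q_def using Cons m by (intro Cons.IH) simp_all
  have "norm (r - x + w) \<le> 2 * real (length xs) * \<delta> * s"
    unfolding r_def s_def w_def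
    using Cons.prems m by (intro norm_foldr_minus_first_order_le) simp_all
  also have "\<dots> \<le> 2 * \<eta> * s" using m \<open>0 \<le> s\<close> by (intro mult_right_mono) auto
  finally have "norm (H i x) * norm (r - x + w) \<le> norm (H i x) * (2 * \<eta> * s)"
    by (intro mult_left_mono) auto
  then have err: "- (H i x \<bullet> (r - x + w)) \<le> norm (H i x) * (2 * \<eta> * s)"
    using Cauchy_Schwarz_ineq2[of "H i x" "r - x + w"] by linarith
  have sym: "x \<bullet> H i r = H i x \<bullet> r" using Cons.prems(3) by simp
  \<comment> \<open>Here \<open>r\<close> is split into its first-order expansion
    \<open>x - w\<close> and the remainder \<open>r - x + w\<close>.\<close>
  have "x \<bullet> (r - H i r) = x \<bullet> r - x \<bullet> H i x + H i x \<bullet> w - H i x \<bullet> (r - x + w)"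
    using sym by (simp add: inner_simps inner_commute)
  also have "\<dots> \<le> (norm x)\<^sup>2 - x \<bullet> (H i x + w)
      + ((norm (H i x + w))\<^sup>2 - ((norm (H i x))\<^sup>2 + q)) / 2
      + \<eta> * ((norm (H i x) + s)\<^sup>2 - ((norm (H i x))\<^sup>2 + q))"
  proof -
    have "(norm (H i x + w))\<^sup>2 = (norm (H i x))\<^sup>2 + 2 * (H i x \<bullet> w) + (norm w)\<^sup>2"
      by (simp add: power2_norm_eq_inner inner_simps inner_commute)
    moreover have "\<eta> * ((norm (H i x) + s)\<^sup>2 - ((norm (H i x))\<^sup>2 + q))
        = norm (H i x) * (2 * \<eta> * s) + \<eta> * (s\<^sup>2 - q)"
      by (simp add: power2_sum algebra_simps)
    ultimately show ?thesis using IH err unfolding inner_add_right by argo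
  qed
  finally show ?case using Cons.prems(7)
    by (simp add: r_def s_def w_def q_def)
qed (simp add: power2_norm_eq_inner)

lemma inner_foldr_minus_bounds:
  fixes H :: "'i \<Rightarrow> 'v::real_inner \<Rightarrow> 'v"
  assumes lin: "\<And>i. i \<in> set xs \<Longrightarrow> linear (H i)"
    and bound: "\<And>i v. i \<in> set xs \<Longrightarrow> norm (H i v) \<le> \<delta> * norm v"
    and sym: "\<And>i u v. i \<in> set xs \<Longrightarrow> u \<bullet> H i v = H i u \<bullet> v"
    and pos: "\<And>v. 0 \<le> v \<bullet> (\<Sum>i\<in>set xs. H i v)"
    and "0 \<le> \<delta>" and small: "4 * (real (length xs))\<^sup>2 * \<delta> \<le> 1" and "distinct xs"
  shows "0 \<le> x \<bullet> foldr (\<lambda>i v. v - H i v) xs x"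
    and "x \<bullet> foldr (\<lambda>i v. v - H i v) xs x \<le> (norm x)\<^sup>2"
proof -
  define n where "n = real (length xs)"
  define T where "T v = (\<Sum>i\<in>set xs. H i v)" for v
  define q where "q = (\<Sum>i\<in>set xs. (norm (H i x))\<^sup>2)"
  have card: "real (card (set xs)) = n" using \<open>distinct xs\<close> by (simp add: distinct_card n_def)
  have "n \<le> n\<^sup>2" "0 \<le> n"
    using le_square[of "length xs"] by (simp_all add: n_def power2_eq_square flip: of_nat_mult)
  then have "n * \<delta> \<le> n\<^sup>2 * \<delta>" using \<open>0 \<le> \<delta>\<close> by (intro mult_right_mono)
  then have nd: "4 * n * \<delta> \<le> 1" using small by (simp add: n_def)
  have sumH: "(\<Sum>i\<in>set xs. norm (H i v)) \<le> n * \<delta> * norm v" for v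
    using sum_bounded_above[of "set xs" "\<lambda>i. norm (H i v)" "\<delta> * norm v"] bound card by simp
  \<comment> \<open>Lower bound: the product moves \<open>x\<close> by at most
    \<open>norm x\<close>, so by Cauchy-Schwarz its inner product with \<open>x\<close> cannot
    become negative.\<close>
  have "norm (foldr (\<lambda>i v. v - H i v) xs x - x) \<le> (1 + 2 * n * \<delta>) * (\<Sum>i\<in>set xs. norm (H i x))"
    unfolding n_def using assms nd by (intro norm_foldr_minus_le) (simp_all add: n_def)
  also have "\<dots> \<le> 2 * (n * \<delta> * norm x)"
    using nd sumH[of x] by (intro mult_mono) (auto intro: sum_nonneg)
  also have "\<dots> \<le> 1 * norm x" unfolding mult.assoc[symmetric] using nd \<open>0 \<le> n\<close> \<open>0 \<le> \<delta>\<close>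
    by (intro mult_right_mono) (auto simp: algebra_simps)
  finally have "norm x * norm (x - foldr (\<lambda>i v. v - H i v) xs x) \<le> norm x * norm x"
    by (intro mult_left_mono) (auto simp: norm_minus_commute)
  then have "x \<bullet> (x - foldr (\<lambda>i v. v - H i v) xs x) \<le> norm x * norm x"
    using norm_cauchy_schwarz order_trans by blast
  then show "0 \<le> x \<bullet> foldr (\<lambda>i v. v - H i v) xs x"
    by (simp add: inner_simps dot_square_norm power2_eq_square)
  have "linear T" unfolding T_def using lin by (intro linear_compose_sum) auto
  then interpret T: linear T .
  have symT: "u \<bullet> T v = T u \<bullet> v" for u v
    unfolding T_def by (simp add: inner_sum_left inner_sum_right sym)
  have normT: "norm (T v) \<le> n * \<delta> * norm v" for v
    unfolding T_def by (rule order_trans[OF norm_sum sumH])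
  have "T x \<bullet> T (T x) \<le> norm (T x) * norm (T (T x))" by (rule norm_cauchy_schwarz)
  also have "\<dots> \<le> norm (T x) * (n * \<delta> * norm (T x))" by (intro mult_left_mono normT) auto
  also have "\<dots> = n * \<delta> * (norm (T x))\<^sup>2" by (simp add: power2_eq_square)
  also have "\<dots> \<le> 1 * (norm (T x))\<^sup>2" using nd \<open>0 \<le> n\<close> \<open>0 \<le> \<delta>\<close>
    by (intro mult_right_mono) (auto simp: mult.assoc)
  finally have TTT: "T x \<bullet> T (T x) \<le> (norm (T x))\<^sup>2" by simp
  \<comment> \<open>Testing positivity of \<open>T\<close> at \<open>x - T x / 2\<close> bounds
    \<open>(norm (T x))\<^sup>2\<close> by \<open>x \<bullet> T x\<close> plus a quarter of
    \<open>T x \<bullet> T (T x)\<close>; this avoids a square root of \<open>T\<close>.\<close>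
  have "0 \<le> (x - (1/2) *\<^sub>R T x) \<bullet> T (x - (1/2) *\<^sub>R T x)" unfolding T_def by (rule pos)
  also have "\<dots> = x \<bullet> T x - (norm (T x))\<^sup>2 + (T x \<bullet> T (T x)) / 4"
    using symT[of x "T x"] by (simp add: T.diff T.scale inner_simps power2_norm_eq_inner
        diff_divide_distrib)
  finally have main: "(norm (T x))\<^sup>2 / 2 \<le> x \<bullet> T x" using TTT zero_le_power2[of "norm (T x)"] by linarith
  have "x \<bullet> foldr (\<lambda>i v. v - H i v) xs x
    \<le> (norm x)\<^sup>2 - x \<bullet> T x + ((norm (T x))\<^sup>2 - q) / 2
      + (n * \<delta>) * ((\<Sum>i\<in>set xs. norm (H i x))\<^sup>2 - q)"
    unfolding T_def q_def n_def
    using inner_foldr_minus_second_order_le[OF lin bound sym \<open>0 \<le> \<delta>\<close> _ order_refl \<open>distinct xs\<close>]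
      nd \<open>0 \<le> n\<close> \<open>0 \<le> \<delta>\<close> by (simp add: n_def)
  moreover have "0 \<le> q" by (simp add: q_def sum_nonneg)
  \<comment> \<open>Cauchy-Schwarz costs a factor \<open>n\<close>; with the
    \<open>n * \<delta>\<close> in front this is where the condition
    \<open>4 * n\<^sup>2 * \<delta> \<le> 1\<close> is used in full, leaving an error of
    \<open>q / 4\<close> against the available \<open>- q / 2\<close>.\<close>
  moreover have "(\<Sum>i\<in>set xs. norm (H i x))\<^sup>2 \<le> n * q"
    using sum_squared_le_sum_of_squares[of "\<lambda>i. norm (H i x)" "set xs"] card q_def
    by (simp add: mult.commute)
  then have "(n * \<delta>) * ((\<Sum>i\<in>set xs. norm (H i x))\<^sup>2 - q) \<le> (n * \<delta>) * (n * q)"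
    using \<open>0 \<le> n\<close> \<open>0 \<le> \<delta>\<close> \<open>0 \<le> q\<close> by (intro mult_left_mono) auto
  moreover have "(n * \<delta>) * (n * q) = (n\<^sup>2 * \<delta>) * q" by (simp add: power2_eq_square)
  moreover have "\<dots> \<le> (1/4) * q"
    using small by (intro mult_right_mono) (auto simp: q_def n_def sum_nonneg)
  ultimately show "x \<bullet> foldr (\<lambda>i v. v - H i v) xs x \<le> (norm x)\<^sup>2"
    using main by argo
qed

section \<open>Symmetric matrices\<close>

text \<open>Polarization: \<open>4 * (f x \<bullet> y)\<close> is a difference of two values of the
  quadratic form, and the parallelogram law bounds it. Taking \<open>y\<close> parallel to
  \<open>f x\<close> with the norm of \<open>x\<close> gives the claim.\<close>

lemma self_adjoint_norm_le:
  fixes f :: "'v::real_inner \<Rightarrow> 'v"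
  assumes "linear f" and sym: "\<And>u v. u \<bullet> f v = f u \<bullet> v"
    and form: "\<And>v. \<bar>v \<bullet> f v\<bar> \<le> c * (norm v)\<^sup>2"
  shows "norm (f x) \<le> c * norm x"
proof (cases "x = 0 \<or> f x = 0")
  case True
  have "0 \<le> c * (norm x)\<^sup>2" using form[of x] by linarith
  then have "x = 0 \<or> 0 \<le> c" by (auto simp: zero_le_mult_iff)
  then show ?thesis using True linear_0[OF assms(1)] by auto
next
  case False
  interpret linear f by fact
  define y where "y = (norm x / norm (f x)) *\<^sub>R f x"
  have y: "norm y = norm x" using False by (simp add: y_def)
  have "4 * (f x \<bullet> y) = (x + y) \<bullet> f (x + y) - (x - y) \<bullet> f (x - y)"
    using sym[of y x] sym[of x y] by (simp add: add diff inner_simps inner_commute)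
  also have "\<dots> \<le> c * (norm (x + y))\<^sup>2 + c * (norm (x - y))\<^sup>2"
    using form[of "x + y"] form[of "x - y"] by linarith
  also have "\<dots> = 2 * c * ((norm x)\<^sup>2 + (norm y)\<^sup>2)"
    by (simp add: power2_norm_eq_inner inner_simps inner_commute algebra_simps)
  also have "\<dots> = 4 * (norm x * (c * norm x))" unfolding y by (simp add: power2_eq_square)
  also have "f x \<bullet> y = norm x * norm (f x)"
    using False by (simp add: y_def dot_square_norm power2_eq_square)
  finally have "norm x * norm (f x) \<le> norm x * (c * norm x)" by simp
  then show ?thesis using False by simp
qed

lemma inner_symmetric_matrix:
  fixes M :: "real ^ 'd ^ 'd"
  assumes "symmetric_matrix M"
  shows "u \<bullet> (M *v v) = (M *v u) \<bullet> v"
  using assms by (metis dot_lmul_matrix symmetric_matrix_def transpose_matrix_vector)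

lemma sum_matrix_vector_mult:
  fixes B :: "'i \<Rightarrow> real ^ 'n ^ 'm"
  shows "(\<Sum>i\<in>I. B i) *v v = (\<Sum>i\<in>I. B i *v v)"
  by (induction I rule: infinite_finite_induct) (simp_all add: matrix_vector_mult_add_rdistrib)

lemma transpose_sum:
  fixes B :: "'i \<Rightarrow> real ^ 'n ^ 'm"
  shows "transpose (\<Sum>i\<in>I. B i) = (\<Sum>i\<in>I. transpose (B i))"
  by (simp add: transpose_def vec_eq_iff)

section \<open>Matrix powers and the top eigenvalue of a positive semidefinite matrix\<close>

lemma matrix_power_eigenvector:
  fixes M :: "real ^ 'd ^ 'd"
  assumes "M *v v = c *\<^sub>R v"
  shows "matrix_power M k *v v = c ^ k *\<^sub>R v"
  by (induction k) (simp_all add: assms matrix_vector_mult_scaleR mult.commute flip: matrix_vector_mul_assoc)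

lemma norm_matrix_power_le:
  fixes M :: "real ^ 'd ^ 'd"
  assumes "\<And>v. norm (M *v v) \<le> c * norm v" and "0 \<le> c"
  shows "norm (matrix_power M k *v v) \<le> c ^ k * norm v"
proof (induction k)
  case (Suc k)
  have "norm (M *v (matrix_power M k *v v)) \<le> c * norm (matrix_power M k *v v)" by (rule assms(1))
  also have "\<dots> \<le> c * (c ^ k * norm v)" by (intro mult_left_mono Suc assms(2))
  finally show ?case by (simp add: mult.assoc flip: matrix_vector_mul_assoc)
qed simp

text \<open>The norm \<open>c\<close> is a singular value, so by symmetry
  \<open>M\<^sup>2 v = c\<^sup>2 v\<close> for some \<open>v \<noteq> 0\<close>. Then
  \<open>w = M v - c v\<close> satisfies \<open>M w = - c w\<close>, which positivity excludes for
  \<open>c > 0\<close> unless \<open>w = 0\<close>.\<close>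

lemma onorm_eigenvalue_of_psd:
  fixes M :: "real ^ 'd ^ 'd"
  assumes "positive_semidefinite M"
  obtains v where "v \<noteq> 0" and "M *v v = onorm ((*v) M) *\<^sub>R v"
proof -
  define c where "c = onorm ((*v) M)"
  have tr: "transpose M = M" and pos: "\<And>x. 0 \<le> x \<bullet> (M *v x)"
    using assms by (auto simp: positive_semidefinite_def symmetric_matrix_def)
  obtain v where v: "v \<noteq> 0" "M *v (M *v v) = c\<^sup>2 *\<^sub>R v" and "0 \<le> c"
    using onorm_in_singular_values[of M]
    by (auto simp: singular_values_def tr c_def simp flip: matrix_vector_mul_assoc)
  define w where "w = M *v v - c *\<^sub>R v"
  have "M *v w = - (c *\<^sub>R w)"
    by (simp add: w_def v matrix_vector_mult_diff_distrib matrix_vector_mult_scaleR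
        power2_eq_square algebra_simps)
  then have *: "c * (w \<bullet> w) \<le> 0" using pos[of w] by simp
  have "M *v v = c *\<^sub>R v"
  proof (cases "c = 0")
    case True
    then show ?thesis using onorm[OF matrix_vector_mul_bounded_linear, of M v] by (simp add: c_def)
  next
    case False
    then have "w \<bullet> w \<le> 0" using * \<open>0 \<le> c\<close> by (simp add: mult_le_0_iff)
    then have "w = 0" by (meson inner_gt_zero_iff not_less)
    then show ?thesis by (simp add: w_def)
  qed
  then show ?thesis using that v(1) by (simp add: c_def)
qed

text \<open>An eigenvector for the norm of \<open>M\<close> is an eigenvector of every power; this
  yields the lower bound on \<open>W_GD\<close>.\<close>

lemma spectral_norm_power_psd_ge:
  fixes M :: "real ^ 'd ^ 'd"
  assumes "positive_semidefinite M"
  shows "onorm ((*v) M) ^ k \<le> spectral_norm (matrix_power M k)"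
proof -
  obtain v where v: "v \<noteq> 0" "M *v v = onorm ((*v) M) *\<^sub>R v"
    by (rule onorm_eigenvalue_of_psd[OF assms])
  have "onorm ((*v) M) ^ k * norm v = norm (matrix_power M k *v v)"
    by (simp add: matrix_power_eigenvector[OF v(2)] onorm_pos_le)
  also have "\<dots> \<le> spectral_norm (matrix_power M k) * norm v"
    unfolding spectral_norm_eq_onorm by (intro onorm matrix_vector_mul_bounded_linear)
  finally show ?thesis using v(1) by simp
qed

section \<open>Products over permutations\<close>

lemma foldr_matrix_mult_vector:
  fixes A :: "'i \<Rightarrow> real ^ 'd ^ 'd"
  shows "foldr (\<lambda>i M. A i ** M) xs (mat 1) *v x = foldr (\<lambda>i v. A i *v v) xs x"
  by (induction xs) (simp_all flip: matrix_vector_mul_assoc)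

lemma foldr_matrix_mult_append:
  fixes A :: "'i \<Rightarrow> real ^ 'd ^ 'd"
  shows "foldr (\<lambda>i M. A i ** M) (xs @ ys) (mat 1)
    = foldr (\<lambda>i M. A i ** M) xs (mat 1) ** foldr (\<lambda>i M. A i ** M) ys (mat 1)"
  by (induction xs) (simp_all add: matrix_mul_assoc)

lemma transpose_foldr_matrix_mult:
  fixes A :: "'i \<Rightarrow> real ^ 'd ^ 'd"
  assumes "\<And>i. i \<in> set xs \<Longrightarrow> symmetric_matrix (A i)"
  shows "transpose (foldr (\<lambda>i M. A i ** M) xs (mat 1)) = foldr (\<lambda>i M. A i ** M) (rev xs) (mat 1)"
  using assms
  by (induction xs)
    (simp_all add: foldr_matrix_mult_append matrix_transpose_mul symmetric_matrix_def del: foldr_append)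

lemma perm_product_conv_map:
  "perm_product n A \<sigma> = foldr (\<lambda>i M. A i ** M) (map \<sigma> [1..<n + 1]) (mat 1)"
  by (simp add: perm_product_def foldr_map comp_def)

text \<open>A single product may fail to be symmetric, but its transpose is the product for
  \<open>\<sigma> \<circ> \<rho>\<close> with \<open>\<rho>\<close> the reversal, and composing with
  \<open>\<rho>\<close> only reindexes the sum.\<close>

lemma symmetric_sum_perm_product:
  fixes A :: "nat \<Rightarrow> real ^ 'd ^ 'd"
  assumes "\<And>i. i \<in> {1..n} \<Longrightarrow> symmetric_matrix (A i)"
  shows "symmetric_matrix (\<Sum>\<sigma> | \<sigma> permutes {1..n}. perm_product n A \<sigma>)"
proof -
  \<comment> \<open>Outside \<open>{1..n}\<close> the reversal must be the identity to satisfy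
    \<open>permutes\<close>.\<close>
  define \<rho> where "\<rho> i = (if i \<in> {1..n} then n + 1 - i else i)" for i
  have \<rho>: "\<rho> permutes {1..n}"
    by (rule bij_imp_permutes, rule bij_betw_byWitness[where f' = \<rho>]) (auto simp: \<rho>_def)
  have rev: "rev [1..<n + 1] = map \<rho> [1..<n + 1]"
    by (rule nth_equalityI) (auto simp: \<rho>_def rev_nth simp del: upt_Suc)
  have "transpose (perm_product n A \<sigma>) = perm_product n A (\<sigma> \<circ> \<rho>)" if "\<sigma> permutes {1..n}" for \<sigma>
  proof -
    have "symmetric_matrix (A i)" if "i \<in> set (map \<sigma> [1..<n + 1])" for i
    proof -
      have "i \<in> \<sigma> ` {1..n}" using that by (auto simp: image_iff)
      then show ?thesis using assms permutes_image[OF \<open>\<sigma> permutes {1..n}\<close>] by auto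
    qed
    then show ?thesis
      by (simp only: perm_product_conv_map transpose_foldr_matrix_mult rev rev_map map_map)
  qed
  then have "(\<Sum>\<sigma> | \<sigma> permutes {1..n}. transpose (perm_product n A \<sigma>))
      = (\<Sum>\<sigma> | \<sigma> permutes {1..n}. perm_product n A (\<sigma> \<circ> \<rho>))"
    by (intro sum.cong) auto
  also have "\<dots> = (\<Sum>\<sigma> | \<sigma> permutes {1..n}. perm_product n A \<sigma>)"
    by (rule sum_permutations_compose_right[OF \<rho>, symmetric])
  also have "(\<Sum>\<sigma> | \<sigma> permutes {1..n}. transpose (perm_product n A \<sigma>))
      = transpose (\<Sum>\<sigma> | \<sigma> permutes {1..n}. perm_product n A \<sigma>)"
    by (simp add: transpose_sum)
  finally show ?thesis by (simp add: symmetric_matrix_def)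
qed

text \<open>The bridge from matrices to the operator estimates: each \<open>A i\<close> is linear,
  so the scalars \<open>c\<close> can be pulled out one at a time.\<close>

lemma perm_product_scaleR:
  fixes A :: "nat \<Rightarrow> real ^ 'd ^ 'd"
  assumes "\<And>i v. i \<in> {1..n} \<Longrightarrow> A i *v v = c *\<^sub>R (v - H i v)"
    and "\<sigma> permutes {1..n}"
  shows "perm_product n A \<sigma> *v x = c ^ n *\<^sub>R foldr (\<lambda>i v. v - H i v) (map \<sigma> [1..<n + 1]) x"
proof -
  have "foldr (\<lambda>i v. A i *v v) xs x = c ^ length xs *\<^sub>R foldr (\<lambda>i v. v - H i v) xs x"
    if "set xs \<subseteq> {1..n}" for xs
    using that
  proof (induction xs)
    case (Cons i xs)
    define r where "r = foldr (\<lambda>i v. v - H i v) xs x"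
    have i: "i \<in> {1..n}" and IH: "foldr (\<lambda>i v. A i *v v) xs x = c ^ length xs *\<^sub>R r"
      using Cons by (simp_all add: r_def)
    have "A i *v (c ^ length xs *\<^sub>R r) = c ^ length xs *\<^sub>R (c *\<^sub>R (r - H i r))"
      unfolding matrix_vector_mult_scaleR assms(1)[OF i] ..
    then show ?case by (simp add: IH r_def mult.commute)
  qed simp
  moreover have "set (map \<sigma> [1..<n + 1]) = {1..n}"
    unfolding set_map using permutes_image[OF assms(2)]
    by (simp add: atLeastLessThanSuc_atLeastAtMost del: upt_Suc)
  moreover have "length (map \<sigma> [1..<n + 1]) = n" by simp
  ultimately show ?thesis
    unfolding perm_product_conv_map foldr_matrix_mult_vector by (metis order_refl)
qed

section \<open>Normalization by the norm of the mean and comparison of the two norms\<close>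

theorem theorem3:
  fixes A :: "nat \<Rightarrow> real ^ 'd ^ 'd" and n K :: nat
  assumes "n \<ge> 2" and "K \<ge> 1"
    and "\<And>i. i \<in> {1..n} \<Longrightarrow> symmetric_matrix (A i)"
    and "\<And>i. i \<in> {1..n} \<Longrightarrow> (1 - 1 / (4 * (real n)\<^sup>2 + 1)) *\<^sub>R mat 1 \<preceq> A i"
    and "\<And>i. i \<in> {1..n} \<Longrightarrow> A i \<preceq> mat 1"
  shows "spectral_norm (W_RS n K A) \<le> spectral_norm (W_GD n K A)"
proof -
  \<comment> \<open>The two constants are matched by
    \<open>1 / (1 - \<epsilon>) = 1 + \<delta>\<close>: dividing by a number \<open>\<mu>\<close> in
    \<open>[1 - \<epsilon>, 1]\<close> puts the forms of the \<open>A i\<close> between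
    \<open>1 - \<epsilon>\<close> and \<open>1 + \<delta>\<close>.\<close>
  define \<epsilon> where "\<epsilon> = 1 / (4 * (real n)\<^sup>2 + 1)"
  define \<delta> where "\<delta> = 1 / (4 * (real n)\<^sup>2)"
  define M where "M = (1 / real n) *\<^sub>R (\<Sum>i = 1..n. A i)"
  define \<mu> where "\<mu> = onorm ((*v) M)"
  define H where "H i v = v - (1 / \<mu>) *\<^sub>R (A i *v v)" for i v
  define S where "S = (1 / fact n) *\<^sub>R (\<Sum>\<sigma> | \<sigma> permutes {1..n}. perm_product n A \<sigma>)"
  have n0: "real n > 0" using assms(1) by simp
  then have pos: "0 < 4 * (real n)\<^sup>2" by simp
  then have "\<epsilon> < 1" "0 < \<delta>" by (simp_all add: \<epsilon>_def \<delta>_def divide_less_eq add_pos_nonneg not_less)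
  have \<delta>: "(1 + \<delta>) * (1 - \<epsilon>) = 1"
  proof -
    define c where "c = 4 * (real n)\<^sup>2"
    have "c > 0" using pos by (simp add: c_def)
    then show ?thesis unfolding \<epsilon>_def \<delta>_def c_def[symmetric] by (simp add: divide_simps)
  qed
  have lo: "(1 - \<epsilon>) * (v \<bullet> v) \<le> v \<bullet> (A i *v v)" if "i \<in> {1..n}" for i v
    using assms(4)[OF that] by (simp add: loewner_le_def positive_semidefinite_def \<epsilon>_def
        matrix_vector_mult_diff_rdistrib inner_simps flip: scaleR_matrix_vector_assoc)
  have hi: "v \<bullet> (A i *v v) \<le> v \<bullet> v" if "i \<in> {1..n}" for i v
    using assms(5)[OF that] by (simp add: loewner_le_def positive_semidefinite_def
        matrix_vector_mult_diff_rdistrib inner_simps)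
  have symA: "u \<bullet> (A i *v v) = (A i *v u) \<bullet> v" if "i \<in> {1..n}" for i u v
    using inner_symmetric_matrix assms(3)[OF that] by blast
  have Mv: "M *v v = (1 / real n) *\<^sub>R (\<Sum>i = 1..n. A i *v v)" for v
    unfolding M_def by (simp add: sum_matrix_vector_mult flip: scaleR_matrix_vector_assoc)
  have Mlo: "(1 - \<epsilon>) * (v \<bullet> v) \<le> v \<bullet> (M *v v)" for v
    using sum_bounded_below[of "{1..n}" "(1 - \<epsilon>) * (v \<bullet> v)" "\<lambda>i. v \<bullet> (A i *v v)"] lo n0
    by (simp add: Mv inner_sum_right field_simps)
  have Mhi: "v \<bullet> (M *v v) \<le> v \<bullet> v" for v
    using sum_bounded_above[of "{1..n}" "\<lambda>i. v \<bullet> (A i *v v)" "v \<bullet> v"] hi n0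
    by (simp add: Mv inner_sum_right field_simps)
  have "symmetric_matrix M"
    using assms(3) unfolding M_def symmetric_matrix_def
    by (simp add: transpose_scalar transpose_sum)
  moreover have "0 \<le> v \<bullet> (M *v v)" for v
    using Mlo[of v] \<open>\<epsilon> < 1\<close> by (meson diff_ge_0_iff_ge inner_ge_zero less_imp_le mult_nonneg_nonneg order_trans)
  ultimately have psd: "positive_semidefinite M"
    by (simp add: positive_semidefinite_def)
  have \<mu>M: "v \<bullet> (M *v v) \<le> \<mu> * (v \<bullet> v)" for v
  proof -
    have "v \<bullet> (M *v v) \<le> norm v * norm (M *v v)" by (rule norm_cauchy_schwarz)
    also have "\<dots> \<le> norm v * (\<mu> * norm v)"
      unfolding \<mu>_def by (intro mult_left_mono onorm matrix_vector_mul_bounded_linear) simp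
    finally show ?thesis by (simp add: dot_square_norm power2_eq_square mult_ac)
  qed
  have \<mu>: "1 - \<epsilon> \<le> \<mu>" "\<mu> \<le> 1"
  proof -
    \<comment> \<open>As \<open>\<mu>\<close> is an eigenvalue of \<open>M\<close>, both form bounds
      can be read off at its eigenvector.\<close>
    obtain v where v: "v \<noteq> 0" "M *v v = \<mu> *\<^sub>R v"
      unfolding \<mu>_def by (rule onorm_eigenvalue_of_psd[OF psd])
    then have "0 < v \<bullet> v" by simp
    then show "1 - \<epsilon> \<le> \<mu>" "\<mu> \<le> 1" using Mlo[of v] Mhi[of v] by (simp_all add: v(2))
  qed
  then have "0 < \<mu>" using \<open>\<epsilon> < 1\<close> by linarith
  define t where "t = 1 / \<mu>"
  have "t * (1 - \<epsilon>) \<le> (1 + \<delta>) * (1 - \<epsilon>)"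
    unfolding \<delta> t_def using \<mu> \<open>0 < \<mu>\<close> by (simp add: field_simps)
  then have t: "t \<le> 1 + \<delta>" "1 \<le> t"
    using \<mu> \<open>0 < \<mu>\<close> \<open>\<epsilon> < 1\<close> mult_right_le_imp_le[of t "1 - \<epsilon>" "1 + \<delta>"]
    by (simp_all add: t_def)
  have "\<epsilon> \<le> \<delta>" unfolding \<epsilon>_def \<delta>_def using pos by (intro divide_left_mono mult_pos_pos add_pos_pos) auto
  have AH: "A i *v v = \<mu> *\<^sub>R (v - H i v)" for i v
    using \<open>0 < \<mu>\<close> by (simp add: H_def)
  have linH: "linear (H i)" for i
    unfolding H_def by (intro linearI) (simp_all add: algebra_simps matrix_vector_mult_scaleR
        matrix_vector_right_distrib)
  have symH: "u \<bullet> H i v = H i u \<bullet> v" if "i \<in> {1..n}" for i u v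
    by (simp add: H_def inner_simps symA[OF that])
  have normH: "norm (H i v) \<le> \<delta> * norm v" if i: "i \<in> {1..n}" for i v
  proof (rule self_adjoint_norm_le[OF linH symH[OF i]])
    fix v
    define a where "a = v \<bullet> (A i *v v)"
    have "0 \<le> (1 - \<epsilon>) * (v \<bullet> v)" using \<open>\<epsilon> < 1\<close> by simp
    then have "0 \<le> a" using lo[OF i, of v] by (simp add: a_def)
    \<comment> \<open>The upper bound on \<open>t * a\<close> gives \<open>- \<delta>\<close> as
      lower bound for the form of \<open>H i\<close>; \<open>a \<le> t * a\<close> gives the upper
      bound \<open>\<epsilon> \<le> \<delta>\<close>.\<close>
    have "t * a \<le> (1 + \<delta>) * (v \<bullet> v)"
      using hi[OF i, of v] t \<open>0 \<le> a\<close> \<open>0 < \<delta>\<close> by (intro mult_mono) (auto simp: a_def)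
    moreover have "(1 - \<delta>) * (v \<bullet> v) \<le> (1 - \<epsilon>) * (v \<bullet> v)"
      using \<open>\<epsilon> \<le> \<delta>\<close> by (intro mult_right_mono) auto
    moreover have "1 * a \<le> t * a" using t(2) \<open>0 \<le> a\<close> by (intro mult_right_mono)
    moreover have "v \<bullet> H i v = v \<bullet> v - t * a" by (simp add: H_def inner_simps a_def t_def)
    ultimately show "\<bar>v \<bullet> H i v\<bar> \<le> \<delta> * (norm v)\<^sup>2"
      using lo[OF i, of v] unfolding a_def[symmetric] power2_norm_eq_inner
      by (simp add: abs_le_iff algebra_simps)
  qed
  have posH: "0 \<le> v \<bullet> (\<Sum>i = 1..n. H i v)" for v
  proof -
    \<comment> \<open>The sum is \<open>n (I - M / \<mu>)\<close>, which is positive because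
      \<open>\<mu>\<close> dominates the form of \<open>M\<close>; this is the reason for
      normalizing by \<open>\<mu>\<close>.\<close>
    have "(\<Sum>i = 1..n. H i v) = real n *\<^sub>R v - t *\<^sub>R (\<Sum>i = 1..n. A i *v v)"
      by (simp add: H_def t_def sum_subtractf scaleR_sum_right sum_constant_scaleR del: sum_constant)
    also have "\<dots> = real n *\<^sub>R (v - t *\<^sub>R (M *v v))"
      using n0 by (simp add: Mv scaleR_diff_right)
    finally have "(\<Sum>i = 1..n. H i v) = real n *\<^sub>R (v - t *\<^sub>R (M *v v))" .
    moreover have "t * (v \<bullet> (M *v v)) \<le> v \<bullet> v"
      using \<mu>M[of v] \<open>0 < \<mu>\<close> by (simp add: t_def field_simps)
    ultimately show ?thesis by (simp add: inner_simps)
  qed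
  have P: "0 \<le> v \<bullet> (perm_product n A \<sigma> *v v)"
    "v \<bullet> (perm_product n A \<sigma> *v v) \<le> \<mu> ^ n * (norm v)\<^sup>2" if \<sigma>: "\<sigma> permutes {1..n}" for \<sigma> v
  proof -
    define xs where "xs = map \<sigma> [1..<n + 1]"
    have xs: "set xs = {1..n}" "length xs = n" "distinct xs"
      using permutes_image[OF \<sigma>] permutes_inj_on[OF \<sigma>]
      by (auto simp: xs_def distinct_map atLeastLessThanSuc_atLeastAtMost simp del: upt_Suc)
    have "4 * (real (length xs))\<^sup>2 * \<delta> \<le> 1" using n0 by (simp add: \<delta>_def xs(2))
    note bounds = inner_foldr_minus_bounds[of xs H \<delta>, unfolded xs(1),
        OF linH normH symH posH less_imp_le[OF \<open>0 < \<delta>\<close>] this xs(3)]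
    have eq: "v \<bullet> (perm_product n A \<sigma> *v v) = \<mu> ^ n * (v \<bullet> foldr (\<lambda>i v. v - H i v) xs v)"
      using perm_product_scaleR[OF AH \<sigma>, where x = v] by (simp add: xs_def)
    show "0 \<le> v \<bullet> (perm_product n A \<sigma> *v v)"
      unfolding eq using \<open>0 < \<mu>\<close> bounds(1)[where x = v] by simp
    show "v \<bullet> (perm_product n A \<sigma> *v v) \<le> \<mu> ^ n * (norm v)\<^sup>2"
      unfolding eq using \<open>0 < \<mu>\<close> bounds(2)[where x = v] by simp
  qed
  have Sv: "v \<bullet> (S *v v)
      = (1 / fact n) * (\<Sum>\<sigma> | \<sigma> permutes {1..n}. v \<bullet> (perm_product n A \<sigma> *v v))" for v
    unfolding S_def
    by (simp add: sum_matrix_vector_mult inner_sum_right flip: scaleR_matrix_vector_assoc)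
  have card: "card {\<sigma>. \<sigma> permutes {1..n}} = fact n" by (simp add: card_permutations)
  have "symmetric_matrix S"
    using symmetric_sum_perm_product[OF assms(3)]
    by (simp add: S_def symmetric_matrix_def transpose_scalar)
  then have "norm (S *v v) \<le> \<mu> ^ n * norm v" for v
  proof (intro self_adjoint_norm_le inner_symmetric_matrix)
    fix v
    \<comment> \<open>Form bounds, unlike symmetry, hold for each \<open>\<sigma>\<close> and pass
      to the average. The lower bound \<open>0\<close> supplies the absolute value, ruling out large
      negative eigenvalues of \<open>S\<close>.\<close>
    have "0 \<le> v \<bullet> (S *v v)" unfolding Sv
      by (intro mult_nonneg_nonneg sum_nonneg) (use P(1) in auto)
    moreover have "v \<bullet> (S *v v) \<le> \<mu> ^ n * (norm v)\<^sup>2"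
      using sum_bounded_above[of "{\<sigma>. \<sigma> permutes {1..n}}"
          "\<lambda>\<sigma>. v \<bullet> (perm_product n A \<sigma> *v v)" "\<mu> ^ n * (norm v)\<^sup>2"] P(2)
      unfolding Sv card by (simp add: field_simps)
    ultimately show "\<bar>v \<bullet> (S *v v)\<bar> \<le> \<mu> ^ n * (norm v)\<^sup>2" by simp
  qed simp
  then have "norm (matrix_power S K *v v) \<le> (\<mu> ^ n) ^ K * norm v" for v
    using \<open>0 < \<mu>\<close> by (intro norm_matrix_power_le) auto
  then have "spectral_norm (W_RS n K A) \<le> \<mu> ^ (n * K)"
    unfolding spectral_norm_eq_onorm W_RS_def S_def[symmetric] power_mult by (intro onorm_le)
  also have "\<dots> \<le> spectral_norm (W_GD n K A)"
    unfolding W_GD_def M_def[symmetric] \<mu>_def by (rule spectral_norm_power_psd_ge[OF psd])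
  finally show ?thesis .
qed

end
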